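(* Let $\theta,\gamma,\nu>0$ satisfy $$4\nu\theta(1+\gamma)^2=\gamma,\qquad 1+2\gamma+\frac{2\gamma\theta^2}{(1+\theta)^2}\le\frac{\theta}{1+\theta}+\frac{\theta^2}{(1+\theta)^2}.$$ There exists a constant $C>0$ depending only on $\theta,\gamma,\nu$ such that the following holds. Let $f:\mathbb{R}^d\to\mathbb{R}$ be convex, continuously differentiable and $L$-smooth for some $L>0$ (i.e. $\|\nabla f(x)-\nabla f(z)\|\le L\|x-z\|$ for all $x,z\in\mathbb{R}^d$), let $x^*$ be a minimizer of $f$, let $x_0\in\mathbb{R}^d$, $\epsilon>0$, and let $\eta_0>0$ satisfy $\eta_0L\le1$. Then for every integer $K\ge1$ with $$K\ge C\left(1+\sqrt{\frac{L\|x_0-x^*\|^2}{\epsilon}}+\ln\frac{1}{\eta_0L}\right),$$ the output $\overline{x}_K$ of Accelerated GRAAL (defined in the context), run for $K$ iterations with parameters $\theta,\gamma,\nu$, starting point $x_0$ and initial stepsize $\eta_0$, satisfies $f(\overline{x}_K)-f(x^* )\le\epsilon$.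
   Context: $\mathbb{R}^d$ is a finite-dimensional Euclidean space with inner product $\langle\cdot,\cdot\rangle$ and norm $\|\cdot\|$. The Bregman divergence of $f$ is $D_f(x;z)=f(x)-f(z)-\langle\nabla f(z),x-z\rangle$. The curvature estimator is $\Lambda(x;z)=\frac{2D_f(x;z)}{\|\nabla f(x)-\nabla f(z)\|^2}$ if $\nabla f(x)\ne\nabla f(z)$ and $\Lambda(x;z)=+\infty$ if $\nabla f(x)=\nabla f(z)$. Accelerated GRAAL with parameters $\theta,\gamma,\nu$, starting point $x_0$, initial stepsize $\eta_0>0$ and number of iterations $K$: set $\alpha_0=\beta_0=1$, $H_0=H_{-1}=\eta_{-1}=\eta_0$, $\tilde{x}_0=\overline{x}_0=x_0$. For $k=0,1,\dots,K-1$ compute, in this order: $\alpha_{k+1}=\frac{(1+\gamma)\eta_k}{H_k+(1+\gamma)\eta_k}$; $x_{k+1}=x_k-\eta_k\nabla f(\tilde{x}_k)$; $\overline{x}_{k+1}=\beta_k\tilde{x}_k+(1-\beta_k)\overline{x}_k$; $\hat{x}_{k+1}=x_{k+1}+\theta(x_{k+1}-x_k)$; $\tilde{x}_{k+1}=\alpha_{k+1}\hat{x}_{k+1}+(1-\alpha_{k+1})\overline{x}_{k+1}$; $\lambda_{k+1}=\min\{\Lambda(\overline{x}_{k+1};\tilde{x}_k),\Lambda(\overline{x}_{k+1};\tilde{x}_{k+1})\}$; $\eta_{k+1}=\min\{(1+\gamma)\eta_k,\ \nu H_{k-1}\lambda_{k+1}/\eta_{k-1}\}$; $H_{k+1}=H_k+\eta_{k+1}$;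 $\beta_{k+1}=\frac{\eta_{k+1}}{\alpha_{k+1}H_{k+1}}$. The output is $\overline{x}_K$. Convention: if $\lambda_{k+1}=+\infty$ then $\nu H_{k-1}\lambda_{k+1}/\eta_{k-1}=+\infty$ (so $\eta_{k+1}=(1+\gamma)\eta_k$). *)

theory Defs
  imports "HOL-Analysis.Analysis"
begin

section \<open>Euclidean spaces of all dimensions inside one type\<close>

text \<open>
  The constant of the theorem must not depend on the dimension.  If the space were a type
  variable of class \<^class>\<open>euclidean_space\<close>, the constant would be chosen after the type, hence
  after the dimension.  Therefore the space of dimension \<open>d\<close> is the set \<open>eucl d\<close> of those
  sequences, in the inner product space of finitely supported real sequences, whose
  coordinates \<open>i \<ge> d\<close> vanish; the dimension is then a bound variable.
\<close>

typedef fseq = "{x :: nat \<Rightarrow> real. finite {i. x i \<noteq> 0}}"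
  morphisms coord Abs_fseq
  by (rule exI[of _ "\<lambda>_. 0"]) simp

setup_lifting type_definition_fseq

lemma finite_supp [simp]: "finite {i. coord x i \<noteq> 0}"
  using coord by blast

lemma fseq_eqI: "(\<And>i. coord x i = coord y i) \<Longrightarrow> x = y"
  by (simp add: coord_inject[symmetric] fun_eq_iff)

instantiation fseq :: real_vector
begin

lift_definition zero_fseq :: fseq is "\<lambda>_. 0" by simp

lift_definition plus_fseq :: "fseq \<Rightarrow> fseq \<Rightarrow> fseq" is "\<lambda>x y i. x i + y i"
  subgoal for x y by (rule finite_subset[of _ "{i. x i \<noteq> 0} \<union> {i. y i \<noteq> 0}"]) auto
  done

lift_definition uminus_fseq :: "fseq \<Rightarrow> fseq" is "\<lambda>x i. - x i" by simp

lift_definition minus_fseq :: "fseq \<Rightarrow> fseq \<Rightarrow> fseq" is "\<lambda>x y i. x i - y i"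
  subgoal for x y by (rule finite_subset[of _ "{i. x i \<noteq> 0} \<union> {i. y i \<noteq> 0}"]) auto
  done

lift_definition scaleR_fseq :: "real \<Rightarrow> fseq \<Rightarrow> fseq" is "\<lambda>r x i. r * x i"
  by (erule rev_finite_subset) auto

instance
  by standard (transfer; simp add: fun_eq_iff algebra_simps)+

end

lemma coord_simps [simp]:
  "coord 0 i = 0"
  "coord (x + y) i = coord x i + coord y i"
  "coord (- x) i = - coord x i"
  "coord (x - y) i = coord x i - coord y i"
  "coord (r *\<^sub>R x) i = r * coord x i"
  by (transfer; simp)+

instantiation fseq :: real_inner
begin

definition inner_fseq :: "fseq \<Rightarrow> fseq \<Rightarrow> real" where
  "inner_fseq x y = (\<Sum>i | coord x i \<noteq> 0. coord x i * coord y i)"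

definition norm_fseq :: "fseq \<Rightarrow> real" where
  "norm_fseq x = sqrt (inner x x)"

definition sgn_fseq :: "fseq \<Rightarrow> fseq" where
  "sgn_fseq x = x /\<^sub>R norm x"

definition dist_fseq :: "fseq \<Rightarrow> fseq \<Rightarrow> real" where
  "dist_fseq x y = norm (x - y)"

definition uniformity_fseq :: "(fseq \<times> fseq) filter" where
  "uniformity_fseq = (INF e\<in>{0 <..}. principal {(x, y). dist x y < e})"

definition open_fseq :: "fseq set \<Rightarrow> bool" where
  "open_fseq U \<longleftrightarrow> (\<forall>x\<in>U. eventually (\<lambda>(x', y). x' = x \<longrightarrow> y \<in> U) uniformity)"

lemma inner_fseq_superset:
  assumes "finite A" "{i. coord x i \<noteq> 0} \<subseteq> A"
  shows "inner x y = (\<Sum>i\<in>A. coord x i * coord y i)"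
  unfolding inner_fseq_def using assms by (intro sum.mono_neutral_left) auto

instance
proof
  fix x y z :: fseq and r :: real
  let ?A = "{i. coord x i \<noteq> 0} \<union> {i. coord y i \<noteq> 0}"
  have A: "finite ?A" by simp
  show "inner x y = inner y x"
    by (subst (1 2) inner_fseq_superset[OF A]) (auto simp: mult.commute)
  show "inner (x + y) z = inner x z + inner y z"
    by (subst (1 2 3) inner_fseq_superset[OF A]) (auto simp: sum.distrib algebra_simps)
  show "inner (r *\<^sub>R x) y = r * inner x y"
    by (subst (1 2) inner_fseq_superset[OF A]) (auto simp: sum_distrib_left algebra_simps)
  show "0 \<le> inner x x"
    by (simp add: inner_fseq_def sum_nonneg)
  have "inner x x = 0 \<longleftrightarrow> (\<forall>i. coord x i = 0)"
    by (auto simp: inner_fseq_def sum_nonneg_eq_0_iff)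
  also have "\<dots> \<longleftrightarrow> x = 0"
    by (auto intro: fseq_eqI)
  finally show "inner x x = 0 \<longleftrightarrow> x = 0" .
qed (rule norm_fseq_def sgn_fseq_def dist_fseq_def uniformity_fseq_def open_fseq_def)+

end

definition eucl :: "nat \<Rightarrow> fseq set" where
  "eucl d = {x. \<forall>i\<ge>d. coord x i = 0}"

lemma subspace_eucl: "subspace (eucl d)"
  by (auto simp: subspace_def eucl_def)

lemma inner_eucl:
  assumes "x \<in> eucl d"
  shows "inner x y = (\<Sum>i<d. coord x i * coord y i)"
  using assms by (intro inner_fseq_superset) (auto simp: eucl_def not_le[symmetric])

lemma coord_image_eucl: "coord ` eucl d = {x. \<forall>i\<ge>d. x i = 0}"
proof -
  have "x \<in> coord ` eucl d" if "\<forall>i\<ge>d. x i = 0" for x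
  proof -
    have "finite {i. x i \<noteq> 0}"
      by (rule finite_subset[of _ "{..<d}"]) (use that in \<open>auto simp: not_le[symmetric]\<close>)
    then have "coord (Abs_fseq x) = x" by (simp add: Abs_fseq_inverse)
    with that show ?thesis by (auto simp: eucl_def image_iff intro!: exI[of _ "Abs_fseq x"])
  qed
  then show ?thesis by (auto simp: eucl_def)
qed

section \<open>Gradients and the curvature estimator\<close>

text \<open>
  \<open>is_gradient_on S f g\<close>: on the subspace \<open>S\<close>, the map \<open>g\<close> is the gradient of \<open>f\<close>.  Requiring
  \<open>g x \<in> S\<close> makes the values of \<open>g\<close> on \<open>S\<close> unique; values of \<open>f\<close> and \<open>g\<close> outside \<open>S\<close> play no role.
\<close>

definition is_gradient_on ::
  "'a::real_inner set \<Rightarrow> ('a \<Rightarrow> real) \<Rightarrow> ('a \<Rightarrow> 'a) \<Rightarrow> bool" where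
  "is_gradient_on S f g \<longleftrightarrow>
     (\<forall>x\<in>S. g x \<in> S \<and> (f has_derivative (\<lambda>h. inner (g x) h)) (at x within S))"

lemma is_gradient_on_unique:
  assumes "subspace S" "is_gradient_on S f g" "is_gradient_on S f g'" "x \<in> S"
  shows "g x = g' x"
proof -
  let ?v = "g x - g' x"
  have v: "?v \<in> S"
    using assms by (auto simp: is_gradient_on_def intro: subspace_diff)
  have line: "((\<lambda>t. x + t *\<^sub>R ?v) has_derivative (\<lambda>t. t *\<^sub>R ?v)) (at (0::real))"
    by (auto intro!: derivative_eq_intros)
  have sub: "range (\<lambda>t. x + t *\<^sub>R ?v) \<subseteq> S"
    using assms(1,4) v by (auto intro: subspace_add subspace_scale)
  have D: "((\<lambda>t. f (x + t *\<^sub>R ?v)) has_derivative (\<lambda>t. inner (k x) (t *\<^sub>R ?v))) (at (0::real))"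
    if "is_gradient_on S f k" for k
  proof -
    have "(f has_derivative (\<lambda>h. inner (k x) h)) (at (x + 0 *\<^sub>R ?v) within range (\<lambda>t. x + t *\<^sub>R ?v))"
      using that assms(4) sub by (auto simp: is_gradient_on_def intro: has_derivative_subset)
    from has_derivative_in_compose[OF line this] show ?thesis by simp
  qed
  have "(\<lambda>t::real. inner (g x) (t *\<^sub>R ?v)) = (\<lambda>t. inner (g' x) (t *\<^sub>R ?v))"
    using has_derivative_unique[OF D D] assms by blast
  from fun_cong[OF this, of 1] have "inner ?v ?v = 0"
    by (simp add: inner_diff_left)
  then show ?thesis by simp
qed

definition bregman :: "('a::real_inner \<Rightarrow> real) \<Rightarrow> ('a \<Rightarrow> 'a) \<Rightarrow> 'a \<Rightarrow> 'a \<Rightarrow> real" where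
  "bregman f g x z = f x - f z - inner (g z) (x - z)"

definition curv :: "('a::real_inner \<Rightarrow> real) \<Rightarrow> ('a \<Rightarrow> 'a) \<Rightarrow> 'a \<Rightarrow> 'a \<Rightarrow> ereal" where
  "curv f g x z =
     (if g x = g z then \<infinity> else ereal (2 * bregman f g x z / (norm (g x - g z))\<^sup>2))"

section \<open>Accelerated GRAAL\<close>

text \<open>
  The state after \<open>k\<close> iterations; \<open>gs_eta_prev\<close> and \<open>gs_H_prev\<close> carry index \<open>k - 1\<close>, the remaining
  fields index \<open>k\<close>.
\<close>

record 'a graal_state =
  gs_alpha :: real
  gs_beta :: real
  gs_eta :: real
  gs_eta_prev :: real
  gs_H :: real
  gs_H_prev :: real
  gs_pt :: 'a
  gs_pt_tilde :: 'a
  gs_pt_bar :: 'a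

definition graal_init :: "'a \<Rightarrow> real \<Rightarrow> 'a graal_state" where
  "graal_init x0 eta0 =
     \<lparr>gs_alpha = 1, gs_beta = 1, gs_eta = eta0, gs_eta_prev = eta0, gs_H = eta0, gs_H_prev = eta0,
      gs_pt = x0, gs_pt_tilde = x0, gs_pt_bar = x0\<rparr>"

definition graal_step ::
  "real \<Rightarrow> real \<Rightarrow> real \<Rightarrow> ('a::real_inner \<Rightarrow> real) \<Rightarrow> ('a \<Rightarrow> 'a)
   \<Rightarrow> 'a graal_state \<Rightarrow> 'a graal_state" where
  "graal_step \<theta> \<gamma> \<nu> f g s =
    (let alpha' = (1 + \<gamma>) * gs_eta s / (gs_H s + (1 + \<gamma>) * gs_eta s);
         x' = gs_pt s - gs_eta s *\<^sub>R g (gs_pt_tilde s);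
         x_bar' = gs_beta s *\<^sub>R gs_pt_tilde s + (1 - gs_beta s) *\<^sub>R gs_pt_bar s;
         x_hat' = x' + \<theta> *\<^sub>R (x' - gs_pt s);
         x_tilde' = alpha' *\<^sub>R x_hat' + (1 - alpha') *\<^sub>R x_bar';
         lambda' = min (curv f g x_bar' (gs_pt_tilde s)) (curv f g x_bar' x_tilde');
         eta' = (if lambda' = \<infinity> then (1 + \<gamma>) * gs_eta s
                 else min ((1 + \<gamma>) * gs_eta s) (\<nu> * gs_H_prev s * real_of_ereal lambda' / gs_eta_prev s));
         H' = gs_H s + eta';
         beta' = eta' / (alpha' * H')
     in \<lparr>gs_alpha = alpha', gs_beta = beta', gs_eta = eta', gs_eta_prev = gs_eta s, gs_H = H', gs_H_prev = gs_H s,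
         gs_pt = x', gs_pt_tilde = x_tilde', gs_pt_bar = x_bar'\<rparr>)"

definition graal_output ::
  "real \<Rightarrow> real \<Rightarrow> real \<Rightarrow> ('a::real_inner \<Rightarrow> real) \<Rightarrow> ('a \<Rightarrow> 'a)
   \<Rightarrow> 'a \<Rightarrow> real \<Rightarrow> nat \<Rightarrow> 'a" where
  "graal_output \<theta> \<gamma> \<nu> f g x0 eta0 K =
     gs_pt_bar ((graal_step \<theta> \<gamma> \<nu> f g ^^ K) (graal_init x0 eta0))"

end

theory Submission
  imports Defs
begin

text \<open>
  Write \<open>d\<^sub>k = x\<^sub>k - x\<^bsub>k-1\<^esub>\<close> and \<open>F = f - f xs\<close>.  Since
  \<open>H\<^sub>k xbar\<^bsub>k+1\<^esub> = \<eta>\<^sub>k xhat\<^sub>k + H\<^bsub>k-1\<^esub> xbar\<^sub>k\<close>, the linear term of the gradient step splits exactly into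
  \<open>H\<^sub>k F(xbar\<^bsub>k+1\<^esub>) - H\<^bsub>k-1\<^esub> F(xbar\<^sub>k)\<close> plus Bregman divergences.  As \<open>xbar\<^bsub>k+1\<^esub>\<close> lies between
  \<open>xtilde\<^sub>k\<close> and \<open>xbar\<^sub>k\<close>, convexity leaves a surplus of divergence, which the stepsize rule turns
  into a bound on the gradient change \<open>\<eta>\<^sub>k (g\<^sub>k - g\<^bsub>k-1\<^esub>) = r d\<^sub>k - d\<^bsub>k+1\<^esub>\<close>, where \<open>g\<^sub>k\<close> is the
  gradient at \<open>xtilde\<^sub>k\<close> and \<open>r = \<eta>\<^sub>k / \<eta>\<^bsub>k-1\<^esub>\<close>.  What remains is a quadratic form in \<open>d\<^sub>k\<close> and
  \<open>d\<^bsub>k+1\<^esub>\<close>, controlled by the conditions on the parameters.  Thus \<open>H\<^bsub>K-1\<^esub> F(xbar\<^sub>K)\<close> is at most a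
  constant times \<open>|x0 - xs|^2\<close>, and \<open>H\<close> grows quadratically after a logarithmic start-up phase.
\<close>

section \<open>Smooth convex functions on a subspace\<close>

text \<open>A line through \<open>x\<close> along \<open>v\<close> stays in \<open>S\<close>, so the
  derivative within \<open>S\<close> becomes an ordinary one-variable derivative.\<close>

lemma is_gradient_on_line:
  assumes S: "subspace S" and gr: "is_gradient_on S f g" and x: "x \<in> S" and v: "v \<in> S"
  shows "((\<lambda>t. f (x + t *\<^sub>R v)) has_real_derivative inner (g (x + t *\<^sub>R v)) v) (at t)"
proof -
  have line: "((\<lambda>t. x + t *\<^sub>R v) has_derivative (\<lambda>t. t *\<^sub>R v)) (at t)"
    by (auto intro!: derivative_eq_intros)
  have mem: "x + s *\<^sub>R v \<in> S" for s
    using S x v by (auto intro: subspace_add subspace_scale)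
  have "(f has_derivative (\<lambda>h. inner (g (x + t *\<^sub>R v)) h))
          (at (x + t *\<^sub>R v) within range (\<lambda>t. x + t *\<^sub>R v))"
    using gr mem by (auto simp: is_gradient_on_def intro: has_derivative_subset)
  from has_derivative_in_compose[OF line this] show ?thesis
    by (simp add: has_field_derivative_def mult_commute_abs)
qed

lemma bregman_nonneg:
  assumes S: "subspace S" and gr: "is_gradient_on S f g" and cv: "convex_on S f"
    and x: "x \<in> S" and z: "z \<in> S"
  shows "0 \<le> bregman f g x z"
proof -
  define v where "v = x - z"
  have v: "v \<in> S" using S x z by (simp add: v_def subspace_diff)
  have mem: "z + s *\<^sub>R v \<in> S" for s
    using S z v by (auto intro: subspace_add subspace_scale)
  have "convex_on UNIV (\<lambda>t. f (z + t *\<^sub>R v))"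
  proof (rule convex_onI)
    fix t s r :: real assume "0 < t" "t < 1"
    moreover have "z + ((1 - t) *\<^sub>R s + t *\<^sub>R r) *\<^sub>R v = (1 - t) *\<^sub>R (z + s *\<^sub>R v) + t *\<^sub>R (z + r *\<^sub>R v)"
      by (simp add: algebra_simps)
    ultimately show "f (z + ((1 - t) *\<^sub>R s + t *\<^sub>R r) *\<^sub>R v) \<le> (1 - t) * f (z + s *\<^sub>R v) + t * f (z + r *\<^sub>R v)"
      using convex_onD[OF cv, of t "z + s *\<^sub>R v" "z + r *\<^sub>R v"] mem by simp
  qed simp
  then have "f (z + 1 *\<^sub>R v) - f (z + 0 *\<^sub>R v) \<ge> inner (g (z + 0 *\<^sub>R v)) v * (1 - 0)"
    by (rule convex_on_imp_above_tangent[where A = UNIV])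
      (use is_gradient_on_line[OF S gr z v, of 0] in auto)
  then show ?thesis by (simp add: bregman_def v_def)
qed

text \<open>The descent lemma: Cauchy-Schwarz and the Lipschitz bound make the derivative of
  \<open>\<phi>\<close> nonpositive on [0, 1].\<close>

lemma bregman_le_smooth:
  assumes S: "subspace S" and gr: "is_gradient_on S f g"
    and lip: "\<And>x z. x \<in> S \<Longrightarrow> z \<in> S \<Longrightarrow> norm (g x - g z) \<le> L * norm (x - z)"
    and x: "x \<in> S" and z: "z \<in> S"
  shows "bregman f g x z \<le> L / 2 * (norm (x - z))\<^sup>2"
proof -
  define v where "v = x - z"
  have v: "v \<in> S" using S x z by (simp add: v_def subspace_diff)
  have mem: "z + s *\<^sub>R v \<in> S" for s
    using S z v by (auto intro: subspace_add subspace_scale)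
  define \<phi> where "\<phi> t = f (z + t *\<^sub>R v) - t * inner (g z) v - L / 2 * t\<^sup>2 * (norm v)\<^sup>2" for t
  have "\<phi> 1 \<le> \<phi> 0"
  proof (rule DERIV_nonpos_imp_nonincreasing[of 0 1])
    fix t :: real assume t: "0 \<le> t" "t \<le> 1"
    have "(\<phi> has_real_derivative inner (g (z + t *\<^sub>R v)) v - inner (g z) v - L * t * (norm v)\<^sup>2) (at t)"
      unfolding \<phi>_def
      by (rule derivative_eq_intros is_gradient_on_line[OF S gr z v] refl | simp)+
    moreover have "inner (g (z + t *\<^sub>R v) - g z) v \<le> norm (g (z + t *\<^sub>R v) - g z) * norm v"
      by (rule norm_cauchy_schwarz)
    moreover have "\<dots> \<le> (L * norm (t *\<^sub>R v)) * norm v"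
      using lip[OF mem z, of t] by (intro mult_right_mono) auto
    ultimately show "\<exists>y. (\<phi> has_real_derivative y) (at t) \<and> y \<le> 0"
      using t by (auto intro!: exI simp: inner_diff_left power2_eq_square mult_ac)
  qed simp
  then show ?thesis by (simp add: \<phi>_def bregman_def v_def)
qed

text \<open>Cocoercivity: the step from \<open>x\<close> to \<open>?w\<close> lowers
  \<open>bregman f g _ z\<close> by at least \<open>(norm (g x - g z))\<^sup>2 / (2 * L)\<close>,
  yet the value at \<open>?w\<close> is nonnegative.\<close>

lemma bregman_ge_smooth:
  assumes S: "subspace S" and gr: "is_gradient_on S f g" and cv: "convex_on S f" and L: "L > 0"
    and lip: "\<And>x z. x \<in> S \<Longrightarrow> z \<in> S \<Longrightarrow> norm (g x - g z) \<le> L * norm (x - z)"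
    and x: "x \<in> S" and z: "z \<in> S"
  shows "(norm (g x - g z))\<^sup>2 / L \<le> 2 * bregman f g x z"
proof -
  let ?v = "g x - g z" and ?w = "x - (1 / L) *\<^sub>R (g x - g z)"
  have "?v \<in> S"
    using gr S x z by (auto simp: is_gradient_on_def intro: subspace_diff)
  then have w: "?w \<in> S" using S x by (auto intro: subspace_diff subspace_scale)
  have "bregman f g ?w z = bregman f g ?w x + bregman f g x z - inner ?v ?v / L"
    by (simp add: bregman_def inner_diff_left inner_diff_right algebra_simps diff_divide_distrib
      add_divide_distrib)
  moreover have "0 \<le> bregman f g ?w z" by (rule bregman_nonneg[OF S gr cv w z])
  moreover have "bregman f g ?w x \<le> L / 2 * (norm (?w - x))\<^sup>2"
    by (rule bregman_le_smooth[OF S gr lip w x])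
  moreover have "?w - x = - (?v /\<^sub>R L)" by (simp add: inverse_eq_divide)
  then have nw: "norm (?w - x) = norm ?v / L"
    using L by (simp only: norm_minus_cancel norm_scaleR) (simp add: divide_inverse_commute)
  have "L / 2 * (norm (?w - x))\<^sup>2 = (norm ?v)\<^sup>2 / (2 * L)"
    unfolding nw using L by (simp add: power_divide field_simps power2_eq_square)
  ultimately show ?thesis
    by (simp add: power2_norm_eq_inner)
qed

text \<open>Otherwise a gradient step from \<open>xs\<close> with stepsize \<open>1 / L\<close>
  would decrease \<open>f\<close> strictly.\<close>

lemma gradient_at_minimum:
  assumes S: "subspace S" and gr: "is_gradient_on S f g" and L: "L > 0"
    and lip: "\<And>x z. x \<in> S \<Longrightarrow> z \<in> S \<Longrightarrow> norm (g x - g z) \<le> L * norm (x - z)"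
    and xs: "xs \<in> S" and min: "\<And>x. x \<in> S \<Longrightarrow> f xs \<le> f x"
  shows "g xs = 0"
proof -
  let ?w = "xs - (1 / L) *\<^sub>R g xs"
  have w: "?w \<in> S"
    using gr S xs by (auto simp: is_gradient_on_def intro: subspace_diff subspace_scale)
  have "bregman f g ?w xs \<le> L / 2 * (norm (?w - xs))\<^sup>2"
    by (rule bregman_le_smooth[OF S gr lip w xs])
  also have "\<dots> = (norm (g xs))\<^sup>2 / (2 * L)"
    using L by (simp add: power_divide field_simps power2_eq_square)
  finally have "inner (g xs) (g xs) / L \<le> inner (g xs) (g xs) / (2 * L)"
    using min[OF w] by (simp add: bregman_def power2_norm_eq_inner)
  then have "inner (g xs) (g xs) \<le> 0" using L by (simp add: field_simps)
  then show ?thesis using inner_ge_zero[of "g xs"] by (metis order_antisym inner_eq_zero_iff)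
qed

text \<open>Convexity of the divergence in its first argument, with value 0 at \<open>z\<close>. It
  serves for \<open>xb (Suc n)\<close>, an average of \<open>xt n\<close> and
  \<open>xb n\<close>.\<close>

lemma bregman_convex_comb_le:
  assumes cv: "convex_on S f" and x: "x \<in> S" and z: "z \<in> S" and b: "0 \<le> b" "b \<le> 1"
  shows "bregman f g (b *\<^sub>R z + (1 - b) *\<^sub>R x) z \<le> (1 - b) * bregman f g x z"
proof -
  have "f (b *\<^sub>R z + (1 - b) *\<^sub>R x) \<le> b * f z + (1 - b) * f x"
    using convex_onD[OF cv, of "1 - b" z x] x z b by simp
  moreover have "b *\<^sub>R z + (1 - b) *\<^sub>R x - z = (1 - b) *\<^sub>R (x - z)"
    by (simp add: algebra_simps)
  ultimately show ?thesis
    unfolding bregman_def by (simp add: algebra_simps)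
qed

section \<open>Growth of the stepsizes\<close>

text \<open>The potential \<open>ln u\<^sub>k + A (sqrt G\<^sub>k + sqrt G\<^bsub>k-2\<^esub>)\<close> grows by \<open>ln q\<close> in each
  step: if \<open>u\<close> drops, then \<open>u\<^bsub>k+1\<^esub> u\<^bsub>k-1\<^esub> \<ge> \<nu> G\<^bsub>k-1\<^esub>\<close>, and the drop of the logarithm is paid for
  by the increments of \<open>sqrt G\<close> at \<open>k - 1\<close> and \<open>k + 1\<close>.\<close>

lemma ln_potential_bound:
  fixes b B y :: real
  assumes b: "b > 0" and y: "y > 0"
  shows "B + 2 * ln y \<le> (4 + \<bar>B\<bar> / sqrt b) * (y / 2 + b / (2 * y))"
proof -
  define m where "m = y / 2 + b / (2 * y)"
  \<comment> \<open>By AM-GM the mean \<open>m\<close> is at least \<open>sqrt b\<close>, which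
    absorbs the constant \<open>B\<close>; being at least \<open>y / 2\<close>, it absorbs the
    logarithm.\<close>
  have "y * (sqrt b * 2) \<le> y\<^sup>2 + (sqrt b)\<^sup>2"
    using sum_squares_bound[of y "sqrt b"] by (simp add: mult_ac)
  then have m1: "sqrt b \<le> m" using b y by (simp add: m_def field_simps power2_eq_square)
  have m2: "y / 2 \<le> m" using b y by (simp add: m_def)
  have "2 * ln y \<le> 4 * m" using ln_le_minus_one[OF y] m2 by simp
  moreover have "\<bar>B\<bar> = \<bar>B\<bar> / sqrt b * sqrt b" using b by simp
  moreover have "\<dots> \<le> \<bar>B\<bar> / sqrt b * m" using m1 b by (intro mult_left_mono) auto
  ultimately show ?thesis unfolding m_def[symmetric] by (simp add: distrib_right)
qed

text \<open>Factor the difference of squares and bound both roots by the larger. Thus a stepsize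
  forces an increment of \<open>sqrt G\<close>.\<close>

lemma sqrt_increment:
  fixes a u :: real
  assumes "a \<ge> 0" "u > 0"
  shows "u / (2 * sqrt (a + u)) \<le> sqrt (a + u) - sqrt a"
proof -
  have p: "sqrt (a + u) > 0" and l: "sqrt a \<le> sqrt (a + u)" using assms by auto
  have "u = (sqrt (a + u) - sqrt a) * (sqrt (a + u) + sqrt a)"
    using assms by (simp add: algebra_simps)
  also have "\<dots> \<le> (sqrt (a + u) - sqrt a) * (2 * sqrt (a + u))"
    using l by (intro mult_left_mono) auto
  finally show ?thesis using p by (simp add: field_simps)
qed

text \<open>Used with \<open>eta k * L\<close> for \<open>u\<close> and \<open>H k * L\<close> for
  \<open>G\<close>. \<open>A\<close> is the factor in \<open>ln_potential_bound\<close> for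
  \<open>B = 2 * ln q - ln \<nu>\<close>; the \<open>1 + q\<close> in \<open>b\<close> bounds the
  growth of \<open>sqrt G\<close> over two steps.\<close>

lemma sqrt_growth:
  fixes u G :: "nat \<Rightarrow> real" and q \<nu> :: real
  defines "b \<equiv> \<nu> / (1 + q)"
  defines "A \<equiv> 4 + \<bar>2 * ln q - ln \<nu>\<bar> / sqrt b"
  assumes q: "q > 1" and nu: "0 < \<nu>" "\<nu> \<le> 1"
    and pos: "\<And>k. u k > 0" and uG: "\<And>k. u k \<le> G k" and GS: "\<And>k. G (Suc k) = G k + u (Suc k)"
    and up: "\<And>k. u (Suc k) \<le> q * u k"
    and lo1: "min (q * u 0) \<nu> \<le> u 1"
    and lo: "\<And>k. min (q * u (Suc k)) (\<nu> * G k / u k) \<le> u (Suc (Suc k))"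
    and u0: "u 0 \<le> 1"
  shows "real n * ln q + ln \<nu> + ln (u 0) \<le> (2 + 2 * A) * sqrt (G (n + 2))"
proof -
  define s where "s k = sqrt (G k)" for k
  have Gpos: "G k > 0" for k using pos[of k] uG[of k] by simp
  have spos: "s k > 0" for k using Gpos by (simp add: s_def)
  have s2: "s k * s k = G k" for k using Gpos[of k] by (simp add: s_def)
  have b: "b > 0" using q nu by (simp add: b_def)
  have A: "A \<ge> 0" using b by (simp add: A_def)
  have inc: "u (Suc k) / (2 * s (Suc k)) \<le> s (Suc k) - s k" for k
    using sqrt_increment[of "G k" "u (Suc k)"] Gpos[of k] pos[of "Suc k"] by (simp add: s_def GS)
  have mono: "s k \<le> s (Suc k)" for k
    using pos[of "Suc k"] by (simp add: s_def GS)
  have ratio: "G (Suc k) \<le> (1 + q) * G k" for k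
  proof -
    have "q * u k \<le> q * G k" using uG[of k] q by (intro mult_left_mono) auto
    then show ?thesis using up[of k] by (simp add: GS algebra_simps)
  qed
  have s2ratio: "s (Suc (Suc k)) \<le> (1 + q) * s k" for k
  proof -
    have "G (Suc (Suc k)) \<le> (1 + q) * ((1 + q) * G k)"
      using q by (intro order_trans[OF ratio[of "Suc k"]] mult_left_mono[OF ratio[of k]]) simp
    then have "s (Suc (Suc k)) \<le> sqrt ((1 + q)\<^sup>2 * G k)"
      unfolding s_def by (intro real_sqrt_le_mono) (simp add: power2_eq_square mult_ac)
    then show ?thesis using q by (simp add: real_sqrt_mult s_def)
  qed
  define \<Phi> where "\<Phi> k = ln (u (k + 2)) + A * s (k + 2) + A * s k" for k
  have step: "\<Phi> k + ln q \<le> \<Phi> (Suc k)" for k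
  proof (cases "q * u (k + 2) \<le> u (k + 3)")
    case True
    have "ln q + ln (u (k + 2)) = ln (q * u (k + 2))"
      using q pos[of "k + 2"] by (simp add: ln_mult)
    also have "\<dots> \<le> ln (u (k + 3))"
      using True q pos[of "k + 2"] by (intro ln_mono) auto
    finally have "ln q + ln (u (k + 2)) \<le> ln (u (k + 3))" .
    moreover have "A * s (k + 2) \<le> A * s (k + 3)" "A * s k \<le> A * s (Suc k)"
      using mono[of k] mono[of "k + 2"] A
      by (auto intro!: mult_left_mono simp: numeral_3_eq_3)
    ultimately show ?thesis by (simp add: \<Phi>_def numeral_3_eq_3)
  next
    case False
    \<comment> \<open>In terms of \<open>y\<close> the scale \<open>s (k + 1)\<close> cancels: the
      logarithm loses at most \<open>ln q - ln \<nu> + 2 * ln y\<close>, while the two increments of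
      \<open>sqrt G\<close> are at least \<open>y / 2\<close> and
      \<open>b / (2 * y)\<close>.\<close>
    define y where "y = u (k + 1) / s (k + 1)"
    have y: "y > 0" using pos spos by (simp add: y_def)
    have ueq: "u (k + 1) = y * s (k + 1)" using spos[of "k+1"] by (simp add: y_def)
    have u3: "\<nu> * s (k + 1) / y \<le> u (k + 3)"
    proof -
      have "\<nu> * G (k + 1) / u (k + 1) \<le> u (k + 3)"
        using lo[of "k + 1"] False by (auto simp: numeral_3_eq_3 min_def split: if_splits)
      moreover have "\<nu> * G (k + 1) / u (k + 1) = \<nu> * s (k + 1) / y"
        unfolding ueq s2[symmetric] using spos[of "k+1"] y by (simp add: field_simps)
      ultimately show ?thesis by simp
    qed
    have u2: "u (k + 2) \<le> q * (y * s (k + 1))"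
      using up[of "k + 1"] ueq by simp
    have "ln (u (k + 2)) \<le> ln (q * (y * s (k + 1)))"
      using u2 pos[of "k + 2"] by (intro ln_mono) auto
    also have "\<dots> = ln q + ln y + ln (s (k + 1))"
      using q y spos[of "k + 1"] by (simp add: ln_mult)
    finally have l2: "ln (u (k + 2)) \<le> ln q + ln y + ln (s (k + 1))" .
    have "ln (\<nu> * s (k + 1) / y) \<le> ln (u (k + 3))"
      using u3 y nu spos[of "k + 1"] by (intro ln_mono) auto
    moreover have "ln (\<nu> * s (k + 1) / y) = ln \<nu> + ln (s (k + 1)) - ln y"
      using nu y spos[of "k + 1"] by (simp add: ln_mult ln_div)
    ultimately have l3: "ln \<nu> + ln (s (k + 1)) - ln y \<le> ln (u (k + 3))" by simp
    have i1: "y / 2 \<le> s (k + 1) - s k"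
      using inc[of k] by (simp add: y_def)
    have "b / (2 * y) = (\<nu> * s (k + 1) / y) / (2 * ((1 + q) * s (k + 1)))"
      using spos[of "k + 1"] by (simp add: b_def)
    also have "\<dots> \<le> u (k + 3) / (2 * s (k + 3))"
      using u3 s2ratio[of "k + 1"] spos[of "k + 3"] pos[of "k+3"] spos[of "k+1"] y nu
      by (intro frac_le) (auto simp: numeral_3_eq_3)
    also have "\<dots> \<le> s (k + 3) - s (k + 2)"
      using inc[of "k + 2"] by (simp add: numeral_3_eq_3)
    finally have i2: "b / (2 * y) \<le> s (k + 3) - s (k + 2)" .
    have "(2 * ln q - ln \<nu>) + 2 * ln y \<le> A * (y / 2 + b / (2 * y))"
      unfolding A_def by (rule ln_potential_bound[OF b y])
    also have "\<dots> \<le> A * ((s (k + 1) - s k) + (s (k + 3) - s (k + 2)))"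
      using i1 i2 A by (intro mult_left_mono) auto
    finally show ?thesis
      using l2 l3 by (simp add: \<Phi>_def numeral_3_eq_3 algebra_simps)
  qed
  have "real n * ln q + \<Phi> 0 \<le> \<Phi> n"
  proof (induction n)
    case (Suc n)
    then show ?case using step[of n] by (simp add: algebra_simps)
  qed simp
  \<comment> \<open>The potential starts at index 2. In the two steps before, the stepsize stays at
    least \<open>\<nu> * u 0\<close>, because the second candidates in both minima are at least
    \<open>\<nu>\<close>.\<close>
  moreover have "ln \<nu> + ln (u 0) \<le> \<Phi> 0"
  proof -
    have le: "\<nu> * u 0 \<le> \<nu>" "\<nu> * u 0 \<le> u 0" "u 0 \<le> q * u 0"
      using nu u0 pos[of 0] q by (auto simp: mult_left_le mult_left_le_one_le)
    have 1: "\<nu> * u 0 \<le> u 1" using lo1 le by (auto simp: min_def split: if_splits)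
    have "u 1 \<le> q * u 1" using q pos[of 1] by simp
    moreover have "\<nu> \<le> \<nu> * G 0 / u 0" using nu uG[of 0] pos[of 0] by (simp add: field_simps)
    ultimately have "\<nu> * u 0 \<le> u 2"
      using lo[of 0] 1 le by (auto simp: min_def numeral_2_eq_2 split: if_splits)
    then have "ln (\<nu> * u 0) \<le> ln (u 2)" using nu pos[of 0] by (intro ln_mono) auto
    moreover have "ln (\<nu> * u 0) = ln \<nu> + ln (u 0)" using nu pos[of 0] by (simp add: ln_mult)
    moreover have "0 \<le> A * s 2" "0 \<le> A * s 0" using A spos[of 0] spos[of 2] by simp_all
    ultimately show ?thesis by (simp add: \<Phi>_def numeral_2_eq_2)
  qed
  moreover have "\<Phi> n \<le> (2 + 2 * A) * s (n + 2)"
  proof -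
    have "ln (u (n + 2)) \<le> ln (s (n + 2) * s (n + 2))"
      unfolding s2 using uG[of "n+2"] pos[of "n+2"] by (intro ln_mono) auto
    also have "\<dots> = 2 * ln (s (n + 2))" using spos[of "n+2"] by (simp add: ln_mult)
    also have "\<dots> \<le> 2 * s (n + 2)" using ln_le_minus_one[OF spos[of "n+2"]] by simp
    finally have "ln (u (n + 2)) \<le> 2 * s (n + 2)" .
    moreover have "A * s n \<le> A * s (n + 2)"
      using mono[of n] mono[of "Suc n"] A by (intro mult_left_mono) auto
    ultimately show ?thesis by (simp add: \<Phi>_def algebra_simps)
  qed
  ultimately show ?thesis by (simp add: s_def)
qed

section \<open>The Lyapunov function\<close>

text \<open>Clearing denominators gives \<open>key\<close>; multiplied by \<theta>, each claim
  follows from it by dropping positive terms. The two bounds serve the quadratic form below.\<close>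

lemma parameter_bounds:
  fixes \<theta> \<gamma> :: real
  assumes th: "\<theta> > 0" and ga: "\<gamma> > 0"
    and "1 + 2 * \<gamma> + 2 * \<gamma> * \<theta>\<^sup>2 / (1 + \<theta>)\<^sup>2 \<le> \<theta> / (1 + \<theta>) + \<theta>\<^sup>2 / (1 + \<theta>)\<^sup>2"
  shows "\<gamma> * (2 * \<theta> + 1) \<le> \<theta>" "(1 + \<theta>) * (1 + \<gamma>) \<le> 2 * \<theta>"
proof -
  have "(1 + 2 * \<gamma> + 2 * \<gamma> * \<theta>\<^sup>2 / (1 + \<theta>)\<^sup>2) * (1 + \<theta>)\<^sup>2
      \<le> (\<theta> / (1 + \<theta>) + \<theta>\<^sup>2 / (1 + \<theta>)\<^sup>2) * (1 + \<theta>)\<^sup>2"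
    using assms(3) by (rule mult_right_mono) simp
  moreover have "(1 + 2 * \<gamma> + 2 * \<gamma> * \<theta>\<^sup>2 / (1 + \<theta>)\<^sup>2) * (1 + \<theta>)\<^sup>2
      = (1 + 2 * \<gamma>) * (1 + \<theta>)\<^sup>2 + 2 * \<gamma> * \<theta>\<^sup>2"
    using th by (simp add: distrib_right algebra_simps)
  moreover have "(\<theta> / (1 + \<theta>) + \<theta>\<^sup>2 / (1 + \<theta>)\<^sup>2) * (1 + \<theta>)\<^sup>2 = \<theta> * (1 + \<theta>) + \<theta>\<^sup>2"
  proof -
    have "\<theta> / (1 + \<theta>) * (1 + \<theta>)\<^sup>2 = \<theta> * (1 + \<theta>)" "\<theta>\<^sup>2 / (1 + \<theta>)\<^sup>2 * (1 + \<theta>)\<^sup>2 = \<theta>\<^sup>2"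
      using th by (simp_all add: power2_eq_square)
    then show ?thesis by (simp only: distrib_right)
  qed
  ultimately have "(1 + 2 * \<gamma>) * (1 + \<theta>)\<^sup>2 + 2 * \<gamma> * \<theta>\<^sup>2 \<le> \<theta> * (1 + \<theta>) + \<theta>\<^sup>2" by simp
  then have key: "1 + 2 * \<gamma> + 4 * (\<gamma> * \<theta>) + 4 * (\<gamma> * \<theta>\<^sup>2) \<le> \<theta>\<^sup>2 - \<theta>"
    by (simp add: power2_eq_square algebra_simps)
  have p: "\<gamma> * \<theta> > 0" "\<gamma> * \<theta>\<^sup>2 > 0" using th ga by auto
  have "\<theta> * (\<gamma> * (2 * \<theta> + 1)) = 2 * (\<gamma> * \<theta>\<^sup>2) + \<gamma> * \<theta>"
    by (simp add: power2_eq_square algebra_simps)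
  also have "\<dots> \<le> \<theta> * \<theta>" using key p th ga unfolding power2_eq_square[symmetric] by linarith
  finally show "\<gamma> * (2 * \<theta> + 1) \<le> \<theta>" using th by simp
  have "\<theta> * ((1 + \<theta>) * (1 + \<gamma>)) = \<theta> + \<theta>\<^sup>2 + \<gamma> * \<theta> + \<gamma> * \<theta>\<^sup>2"
    by (simp add: power2_eq_square algebra_simps)
  also have "\<dots> \<le> 2 * \<theta>\<^sup>2" using key p th ga by linarith
  also have "\<dots> = \<theta> * (2 * \<theta>)" by (simp add: power2_eq_square)
  finally show "(1 + \<theta>) * (1 + \<gamma>) \<le> 2 * \<theta>" using th by simp
qed

text \<open>\<open>p\<close>, \<open>q\<close>, \<open>w\<close> are the coefficients of right side
  minus left side as a quadratic form in \<open>d'\<close> and \<open>d\<close>. It is nonnegative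
  since \<open>w > 0\<close> and \<open>p * w - q\<^sup>2 \<ge> 0\<close>.\<close>

lemma increment_quadratic_form:
  fixes d d' :: "'a::real_inner"
  assumes th: "\<theta> > 0" and ga: "\<gamma> > 0" and r: "0 \<le> r" "r \<le> 1 + \<gamma>"
    and par: "\<gamma> * (2 * \<theta> + 1) \<le> \<theta>" "(1 + \<theta>) * (1 + \<gamma>) \<le> 2 * \<theta>"
  shows "(1 + \<theta>) * (norm d')\<^sup>2 - 2 * \<theta> * inner d' d - \<theta> * (norm d)\<^sup>2
    \<le> \<theta> / \<gamma> * (norm (d' - r *\<^sub>R d))\<^sup>2"
proof -
  define p q w where "p = \<theta> / \<gamma> - \<theta> - 1" and "q = \<theta> - \<theta> * r / \<gamma>" and "w = \<theta> * r\<^sup>2 / \<gamma> + \<theta>"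
  have w: "w > 0" using th ga by (simp add: w_def add_nonneg_pos)
  \<comment> \<open>This bounds \<open>(1 + \<theta>) * r\<^sup>2\<close> by
    \<open>2 * r * \<theta>\<close>, so \<open>r\<close> drops out of the determinant and
    \<open>par(1)\<close> covers the rest.\<close>
  have "(1 + \<theta>) * r * r \<le> (1 + \<theta>) * r * (1 + \<gamma>)"
    using r th by (intro mult_left_mono) auto
  also have "\<dots> = r * ((1 + \<theta>) * (1 + \<gamma>))" by simp
  also have "\<dots> \<le> r * (2 * \<theta>)" using par(2) r by (intro mult_left_mono) auto
  finally have "0 \<le> \<theta> - (1 + \<theta>) * r\<^sup>2 - \<gamma> * (2 * \<theta> + 1) + 2 * r * \<theta>"
    using par(1) by (simp add: power2_eq_square mult_ac)
  then have "0 \<le> \<theta> / \<gamma> * (\<theta> - (1 + \<theta>) * r\<^sup>2 - \<gamma> * (2 * \<theta> + 1) + 2 * r * \<theta>)"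
    using th ga by (intro mult_nonneg_nonneg) auto
  also have "\<dots> = p * w - q\<^sup>2"
    using ga by (simp add: p_def q_def w_def power2_eq_square field_simps)
  finally have det: "0 \<le> p * w - q\<^sup>2" .
  have "w * (p * inner d' d' + 2 * q * inner d' d + w * inner d d)
      = inner (q *\<^sub>R d' + w *\<^sub>R d) (q *\<^sub>R d' + w *\<^sub>R d) + (p * w - q\<^sup>2) * inner d' d'"
    by (simp add: inner_add_left inner_add_right inner_commute algebra_simps power2_eq_square)
  also have "\<dots> \<ge> 0" using det by simp
  finally have "0 \<le> p * inner d' d' + 2 * q * inner d' d + w * inner d d"
    using w by (simp add: zero_le_mult_iff)
  also have "\<dots> = \<theta> / \<gamma> * inner (d' - r *\<^sub>R d) (d' - r *\<^sub>R d)
      - ((1 + \<theta>) * inner d' d' - 2 * \<theta> * inner d' d - \<theta> * inner d d)"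
    using ga by (simp add: p_def q_def w_def inner_diff_left inner_diff_right inner_commute
      field_simps power2_eq_square)
  finally show ?thesis by (simp add: power2_norm_eq_inner)
qed

section \<open>The iterates of Accelerated GRAAL\<close>

text \<open>No dimension enters: \<open>S\<close> is any subspace of an inner product space. The
  second parameter condition enters through \<open>par\<close>.\<close>

locale graal =
  fixes S :: "'a::real_inner set" and f :: "'a \<Rightarrow> real" and g :: "'a \<Rightarrow> 'a"
    and L \<theta> \<gamma> \<nu> eta0 :: real and xs x0 :: 'a
  assumes S: "subspace S" and cv: "convex_on S f" and gr: "is_gradient_on S f g"
    and L: "L > 0"
    and lip: "\<And>x z. x \<in> S \<Longrightarrow> z \<in> S \<Longrightarrow> norm (g x - g z) \<le> L * norm (x - z)"
    and xs: "xs \<in> S" and min: "\<And>x. x \<in> S \<Longrightarrow> f xs \<le> f x"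
    and x0: "x0 \<in> S" and eta0: "eta0 > 0" "eta0 * L \<le> 1"
    and th: "\<theta> > 0" and ga: "\<gamma> > 0" and nu: "\<nu> > 0"
    and nu_eq: "4 * \<nu> * \<theta> * (1 + \<gamma>)\<^sup>2 = \<gamma>"
    and par: "\<gamma> * (2 * \<theta> + 1) \<le> \<theta>" "(1 + \<theta>) * (1 + \<gamma>) \<le> 2 * \<theta>"
begin

abbreviation D :: "'a \<Rightarrow> 'a \<Rightarrow> real" where "D \<equiv> bregman f g"

definition st :: "nat \<Rightarrow> 'a graal_state" where
  "st n = (graal_step \<theta> \<gamma> \<nu> f g ^^ n) (graal_init x0 eta0)"

abbreviation eta :: "nat \<Rightarrow> real" where "eta n \<equiv> gs_eta (st n)"
abbreviation etap :: "nat \<Rightarrow> real" where "etap n \<equiv> gs_eta_prev (st n)"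
abbreviation H :: "nat \<Rightarrow> real" where "H n \<equiv> gs_H (st n)"
abbreviation Hp :: "nat \<Rightarrow> real" where "Hp n \<equiv> gs_H_prev (st n)"
abbreviation x :: "nat \<Rightarrow> 'a" where "x n \<equiv> gs_pt (st n)"
abbreviation xt :: "nat \<Rightarrow> 'a" where "xt n \<equiv> gs_pt_tilde (st n)"
abbreviation xb :: "nat \<Rightarrow> 'a" where "xb n \<equiv> gs_pt_bar (st n)"
abbreviation al :: "nat \<Rightarrow> real" where "al n \<equiv> gs_alpha (st n)"
abbreviation be :: "nat \<Rightarrow> real" where "be n \<equiv> gs_beta (st n)"
abbreviation lam :: "nat \<Rightarrow> ereal" where
  "lam n \<equiv> min (curv f g (xb (Suc n)) (xt n)) (curv f g (xb (Suc n)) (xt (Suc n)))"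

section \<open>Unfolding of the recursion\<close>

lemma st_0: "st 0 = graal_init x0 eta0"
  by (simp add: st_def)

lemma st_Suc:
  "al (Suc n) = (1 + \<gamma>) * eta n / (H n + (1 + \<gamma>) * eta n)"
  "x (Suc n) = x n - eta n *\<^sub>R g (xt n)"
  "xb (Suc n) = be n *\<^sub>R xt n + (1 - be n) *\<^sub>R xb n"
  "xt (Suc n) = al (Suc n) *\<^sub>R (x (Suc n) + \<theta> *\<^sub>R (x (Suc n) - x n)) + (1 - al (Suc n)) *\<^sub>R xb (Suc n)"
  "eta (Suc n) = (if lam n = \<infinity> then (1 + \<gamma>) * eta n
     else min ((1 + \<gamma>) * eta n) (\<nu> * Hp n * real_of_ereal (lam n) / etap n))"
  "etap (Suc n) = eta n"
  "H (Suc n) = H n + eta (Suc n)"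
  "Hp (Suc n) = H n"
  "be (Suc n) = eta (Suc n) / (al (Suc n) * H (Suc n))"
proof -
  have "st (Suc n) = graal_step \<theta> \<gamma> \<nu> f g (st n)" by (simp add: st_def)
  note e = this[unfolded graal_step_def Let_def]
  show "al (Suc n) = (1 + \<gamma>) * eta n / (H n + (1 + \<gamma>) * eta n)"
    "x (Suc n) = x n - eta n *\<^sub>R g (xt n)"
    "xb (Suc n) = be n *\<^sub>R xt n + (1 - be n) *\<^sub>R xb n"
    "xt (Suc n) = al (Suc n) *\<^sub>R (x (Suc n) + \<theta> *\<^sub>R (x (Suc n) - x n)) + (1 - al (Suc n)) *\<^sub>R xb (Suc n)"
    "eta (Suc n) = (if lam n = \<infinity> then (1 + \<gamma>) * eta n
      else min ((1 + \<gamma>) * eta n) (\<nu> * Hp n * real_of_ereal (lam n) / etap n))"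
    "etap (Suc n) = eta n"
    "H (Suc n) = H n + eta (Suc n)"
    "Hp (Suc n) = H n"
    "be (Suc n) = eta (Suc n) / (al (Suc n) * H (Suc n))"
    unfolding e by simp_all
qed

lemma in_S: "x n \<in> S \<and> xt n \<in> S \<and> xb n \<in> S"
proof (induction n)
  case 0
  show ?case using x0 by (simp add: st_0 graal_init_def)
next
  case (Suc n)
  have "g (xt n) \<in> S" using Suc gr by (simp add: is_gradient_on_def)
  then have x: "x (Suc n) \<in> S" unfolding st_Suc(2)
    using Suc S by (auto intro: subspace_diff subspace_scale)
  have xb: "xb (Suc n) \<in> S" unfolding st_Suc(3)
    using Suc S by (auto intro: subspace_add subspace_scale)
  show ?case using x xb unfolding st_Suc(4)
    using Suc S by (auto intro!: subspace_add subspace_scale subspace_diff)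
qed

lemmas x_in = in_S[THEN conjunct1] and xt_in = in_S[THEN conjunct2, THEN conjunct1]
  and xb_in = in_S[THEN conjunct2, THEN conjunct2]

section \<open>Consequences of the stepsize rule\<close>

lemma D_nonneg: "y \<in> S \<Longrightarrow> z \<in> S \<Longrightarrow> 0 \<le> D y z"
  by (rule bregman_nonneg[OF S gr cv])

lemma curv_ge: "y \<in> S \<Longrightarrow> z \<in> S \<Longrightarrow> ereal (1 / L) \<le> curv f g y z"
  using bregman_ge_smooth[OF S gr cv L lip, of y z] L by (auto simp: curv_def field_simps)

text \<open>Separating the infinite estimate leaves real arithmetic elsewhere. The bound
  \<open>1 / L\<close> is cocoercivity; the last two inequalities are \<open>curv\<close> with the
  denominator cleared.\<close>

lemma lam_cases:
  obtains "lam n = \<infinity>" "g (xb (Suc n)) = g (xt n)" "g (xb (Suc n)) = g (xt (Suc n))"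
  | l where "lam n = ereal l" "1 / L \<le> l"
      "l * (norm (g (xb (Suc n)) - g (xt n)))\<^sup>2 \<le> 2 * D (xb (Suc n)) (xt n)"
      "l * (norm (g (xb (Suc n)) - g (xt (Suc n))))\<^sup>2 \<le> 2 * D (xb (Suc n)) (xt (Suc n))"
proof (cases "lam n = \<infinity>")
  case True
  then have "g (xb (Suc n)) = g (xt n)" "g (xb (Suc n)) = g (xt (Suc n))"
    by (auto simp: curv_def min_def split: if_splits)
  with True show ?thesis by (rule that(1))
next
  case False
  have ge: "ereal (1 / L) \<le> lam n"
    by (simp add: curv_ge xb_in xt_in)
  then obtain l where l: "lam n = ereal l" using False by (cases "lam n") auto
  have curvD: "l * (norm (g y - g z))\<^sup>2 \<le> 2 * D y z"
    if "ereal l \<le> curv f g y z" "y \<in> S" "z \<in> S" for y z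
    using that D_nonneg[of y z] by (cases "g y = g z") (auto simp: curv_def pos_le_divide_eq)
  have "ereal l \<le> curv f g (xb (Suc n)) (xt n)" "ereal l \<le> curv f g (xb (Suc n)) (xt (Suc n))"
    unfolding l[symmetric] by simp_all
  then show ?thesis using l ge curvD xb_in xt_in by (intro that(2)[of l]) auto
qed

text \<open>A joint induction, since positivity of the next stepsize rests on \<open>Hp\<close> and
  \<open>etap\<close>. The last bound starts from \<open>eta 0 = etap 0\<close>.\<close>

lemma positive: "0 < eta n \<and> 0 < etap n \<and> eta n \<le> H n \<and> Hp n \<le> H n \<and> 0 < Hp n
   \<and> eta n \<le> (1 + \<gamma>) * etap n"
proof (induction n)
  case 0
  show ?case using eta0 ga by (simp add: st_0 graal_init_def)
next
  case (Suc n)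
  have "0 < eta (Suc n) \<and> eta (Suc n) \<le> (1 + \<gamma>) * eta n"
  proof (cases n rule: lam_cases)
    case 1
    then show ?thesis using Suc ga st_Suc(5)[of n] by simp
  next
    case (2 l)
    have "0 < l" using 2(2) L by (meson divide_pos_pos less_le_trans zero_less_one)
    then show ?thesis using Suc nu ga st_Suc(5)[of n] by (simp add: 2(1))
  qed
  then show ?case using Suc by (simp add: st_Suc(6-8))
qed

lemma eta_pos: "0 < eta n" and etap_pos: "0 < etap n" and eta_le_H: "eta n \<le> H n"
  and Hp_le: "Hp n \<le> H n" and Hp_pos: "0 < Hp n" and eta_le: "eta n \<le> (1 + \<gamma>) * etap n"
  using positive[of n] by auto

lemma H_pos: "0 < H n"
  using eta_pos[of n] eta_le_H[of n] by simp

text \<open>The rule is monotone in the estimate, which is at least \<open>1 / L\<close>. This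
  drives the growth of the stepsizes.\<close>

lemma eta_ge: "min ((1 + \<gamma>) * eta n) (\<nu> * Hp n / (L * etap n)) \<le> eta (Suc n)"
proof (cases n rule: lam_cases)
  case 1
  then show ?thesis using st_Suc(5)[of n] by simp
next
  case (2 l)
  have "\<nu> * Hp n * (1 / L) / etap n \<le> \<nu> * Hp n * l / etap n"
    using 2(2) nu Hp_pos[of n] etap_pos[of n] by (intro divide_right_mono mult_left_mono) auto
  then show ?thesis using st_Suc(5)[of n] by (simp add: 2(1) min_le_iff_disj)
qed

text \<open>The second candidate in the rule caps \<open>eta (Suc n)\<close>, and its factor
  \<open>l\<close> converts the squared gradient gap into a divergence. With an infinite estimate
  the gap is 0.\<close>

lemma eta_curv:
  assumes z: "z \<in> {xt n, xt (Suc n)}"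
  shows "eta (Suc n) * (norm (g (xb (Suc n)) - g z))\<^sup>2 \<le> \<nu> * Hp n / etap n * (2 * D (xb (Suc n)) z)"
proof -
  have c: "0 \<le> \<nu> * Hp n / etap n" using nu Hp_pos[of n] etap_pos[of n] by simp
  show ?thesis
  proof (cases n rule: lam_cases)
    case 1
    then have "g (xb (Suc n)) = g z" using z by auto
    moreover have "0 \<le> \<nu> * Hp n / etap n * (2 * D (xb (Suc n)) z)"
      using c D_nonneg[OF xb_in, of z] z xt_in by (intro mult_nonneg_nonneg) auto
    ultimately show ?thesis by simp
  next
    case (2 l)
    have "eta (Suc n) * (norm (g (xb (Suc n)) - g z))\<^sup>2 \<le> (\<nu> * Hp n * l / etap n) * (norm (g (xb (Suc n)) - g z))\<^sup>2"
      using st_Suc(5)[of n] by (intro mult_right_mono) (auto simp: 2(1))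
    also have "\<dots> = \<nu> * Hp n / etap n * (l * (norm (g (xb (Suc n)) - g z))\<^sup>2)" by simp
    also have "\<dots> \<le> \<nu> * Hp n / etap n * (2 * D (xb (Suc n)) z)"
      using 2 z c by (intro mult_left_mono) auto
    finally show ?thesis .
  qed
qed

section \<open>Averaging weights and one-step identities\<close>

lemma al_bounds: "0 < al (Suc n)"
  using eta_pos[of n] H_pos[of n] ga by (simp add: st_Suc(1) add_pos_pos)

text \<open>\<open>t / (H n + t)\<close> increases in \<open>t\<close>, and
  \<open>al (Suc n)\<close> is its value at the largest stepsize allowed,
  \<open>(1 + \<gamma>) * eta n\<close>. So \<open>xb (Suc (Suc n))\<close> is a convex
  combination.\<close>

lemma be_bounds: "0 \<le> be (Suc n) \<and> be (Suc n) \<le> 1"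
proof -
  have le: "eta (Suc n) \<le> (1 + \<gamma>) * eta n"
    using eta_le[of "Suc n"] by (simp add: st_Suc(6))
  have "eta (Suc n) * (H n + (1 + \<gamma>) * eta n) \<le> (1 + \<gamma>) * eta n * (H n + eta (Suc n))"
    using mult_right_mono[OF le, of "H n"] H_pos[of n] by (simp add: algebra_simps)
  then have "eta (Suc n) \<le> al (Suc n) * H (Suc n)"
    using eta_pos[of n] H_pos[of n] ga
    by (simp add: st_Suc(1) st_Suc(7) pos_le_divide_eq add_pos_pos)
  then show ?thesis
    using eta_pos[of "Suc n"] al_bounds[of n] H_pos[of "Suc n"] by (simp add: st_Suc(9))
qed

text \<open>The weight of \<open>D (xb (Suc n)) (xt (Suc n))\<close> that convexity leaves over; see
  \<open>slack_eq\<close>.\<close>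

definition slack :: "nat \<Rightarrow> real" where
  "slack n = eta (Suc n) * H n / ((1 + \<gamma>) * eta n)"

lemma slack_eq: "H n - (1 - be (Suc n)) * H (Suc n) = slack n"
proof -
  have "be (Suc n) * H (Suc n) = eta (Suc n) / al (Suc n)"
    using H_pos[of "Suc n"] by (simp add: st_Suc(9))
  also have "\<dots> = eta (Suc n) * (H n + (1 + \<gamma>) * eta n) / ((1 + \<gamma>) * eta n)"
    by (simp add: st_Suc(1))
  also have "\<dots> = slack n + eta (Suc n)"
    using eta_pos[of n] ga by (simp add: slack_def distrib_left add_divide_distrib)
  finally show ?thesis by (simp add: st_Suc(7) algebra_simps)
qed

text \<open>The choice of \<open>be\<close> gives the extrapolated point the weight
  \<open>eta (Suc n)\<close>, so the remaining weight \<open>H n\<close> stays on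
  \<open>xb (Suc n)\<close>.\<close>

lemma average:
  "eta (Suc n) *\<^sub>R (x (Suc n) + \<theta> *\<^sub>R (x (Suc n) - x n)) = H (Suc n) *\<^sub>R xb (Suc (Suc n)) - H n *\<^sub>R xb (Suc n)"
proof -
  let ?h = "x (Suc n) + \<theta> *\<^sub>R (x (Suc n) - x n)"
  let ?b = "be (Suc n)" and ?a = "al (Suc n)"
  have c: "H (Suc n) * (?b * ?a) = eta (Suc n)"
    using al_bounds[of n] H_pos[of "Suc n"] by (simp add: st_Suc(9))
  have "H (Suc n) *\<^sub>R xb (Suc (Suc n))
      = (H (Suc n) * (?b * ?a)) *\<^sub>R ?h + (H (Suc n) - H (Suc n) * (?b * ?a)) *\<^sub>R xb (Suc n)"
    unfolding st_Suc(3)[of "Suc n"] st_Suc(4)[of n] by (simp add: algebra_simps)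
  also have "\<dots> = eta (Suc n) *\<^sub>R ?h + H n *\<^sub>R xb (Suc n)"
    unfolding c by (simp add: st_Suc(7))
  finally show ?thesis by simp
qed

text \<open>Expanding the square around \<open>x (Suc n)\<close> cancels the inner product with
  \<open>x (Suc n) - xs\<close>; the cross term stems from the extrapolation by \<theta>.\<close>

lemma distance_identity:
  "(norm (x (Suc (Suc n)) - xs))\<^sup>2 / 2
     + inner (g (xt (Suc n))) (H (Suc n) *\<^sub>R xb (Suc (Suc n)) - H n *\<^sub>R xb (Suc n) - eta (Suc n) *\<^sub>R xs)
   = (norm (x (Suc n) - xs))\<^sup>2 / 2 + (norm (x (Suc (Suc n)) - x (Suc n)))\<^sup>2 / 2
     - \<theta> * inner (x (Suc (Suc n)) - x (Suc n)) (x (Suc n) - x n)"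
proof -
  define p d d' where "p = x (Suc n) - xs" and "d = x (Suc n) - x n"
    and "d' = x (Suc (Suc n)) - x (Suc n)"
  have d': "eta (Suc n) *\<^sub>R g (xt (Suc n)) = - d'" unfolding d'_def st_Suc(2)[of "Suc n"] by simp
  have "H (Suc n) *\<^sub>R xb (Suc (Suc n)) - H n *\<^sub>R xb (Suc n) - eta (Suc n) *\<^sub>R xs
      = eta (Suc n) *\<^sub>R (p + \<theta> *\<^sub>R d)"
    unfolding average[symmetric] p_def d_def by (simp add: algebra_simps)
  then have "inner (g (xt (Suc n))) (H (Suc n) *\<^sub>R xb (Suc (Suc n)) - H n *\<^sub>R xb (Suc n) - eta (Suc n) *\<^sub>R xs)
      = inner (eta (Suc n) *\<^sub>R g (xt (Suc n))) (p + \<theta> *\<^sub>R d)"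
    by simp
  also have "\<dots> = - inner d' p - \<theta> * inner d' d"
    unfolding d' by (simp add: inner_add_right)
  finally have 1: "inner (g (xt (Suc n))) (H (Suc n) *\<^sub>R xb (Suc (Suc n)) - H n *\<^sub>R xb (Suc n) - eta (Suc n) *\<^sub>R xs)
      = - inner d' p - \<theta> * inner d' d" .
  have "x (Suc (Suc n)) - xs = p + d'" by (simp add: p_def d'_def)
  then have "(norm (x (Suc (Suc n)) - xs))\<^sup>2 = (norm p)\<^sup>2 + 2 * inner d' p + (norm d')\<^sup>2"
    by (simp add: power2_norm_eq_inner inner_add_left inner_add_right inner_commute)
  then show ?thesis unfolding 1 p_def[symmetric] d_def[symmetric] d'_def[symmetric] by (simp add: add_divide_distrib)
qed

text \<open>The weights \<open>H (Suc n)\<close>, \<open>- H n\<close> and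
  \<open>- eta (Suc n)\<close> sum to 0, so \<open>f (xt (Suc n))\<close> drops out.\<close>

lemma linearization_identity:
  "inner (g (xt (Suc n))) (H (Suc n) *\<^sub>R xb (Suc (Suc n)) - H n *\<^sub>R xb (Suc n) - eta (Suc n) *\<^sub>R xs)
   = H (Suc n) * (f (xb (Suc (Suc n))) - f xs) - H n * (f (xb (Suc n)) - f xs)
     + eta (Suc n) * D xs (xt (Suc n)) + H n * D (xb (Suc n)) (xt (Suc n))
     - H (Suc n) * D (xb (Suc (Suc n))) (xt (Suc n))"
  by (simp add: bregman_def st_Suc(7) inner_diff_right algebra_simps)

lemma linearization_ge:
  "inner (g (xt (Suc n))) (H (Suc n) *\<^sub>R xb (Suc (Suc n)) - H n *\<^sub>R xb (Suc n) - eta (Suc n) *\<^sub>R xs)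
   \<ge> H (Suc n) * (f (xb (Suc (Suc n))) - f xs) - H n * (f (xb (Suc n)) - f xs)
     + slack n * D (xb (Suc n)) (xt (Suc n))"
proof -
  have "H (Suc n) * D (xb (Suc (Suc n))) (xt (Suc n))
      \<le> H (Suc n) * ((1 - be (Suc n)) * D (xb (Suc n)) (xt (Suc n)))"
    unfolding st_Suc(3)[of "Suc n"] using H_pos[of "Suc n"] be_bounds[of n] xb_in xt_in
    by (intro mult_left_mono bregman_convex_comb_le[OF cv]) auto
  moreover have "slack n * D (xb (Suc n)) (xt (Suc n)) = H n * D (xb (Suc n)) (xt (Suc n))
      - H (Suc n) * ((1 - be (Suc n)) * D (xb (Suc n)) (xt (Suc n)))"
    unfolding slack_eq[symmetric] by (simp add: algebra_simps)
  moreover have "0 \<le> eta (Suc n) * D xs (xt (Suc n))"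
    using eta_pos[of "Suc n"] D_nonneg[OF xs xt_in] by simp
  ultimately show ?thesis unfolding linearization_identity by linarith
qed

text \<open>The half of the divergence gained in one step that is kept to absorb the change of the
  gradient in the next one.\<close>

definition carry :: "nat \<Rightarrow> real" where
  "carry n = eta n * Hp n / ((1 + \<gamma>) * etap n) * D (xb (Suc n)) (xt n) / 2"

text \<open>The coefficient in \<open>carry (Suc n)\<close> is half of \<open>slack n\<close>, and
  passing from \<open>xb (Suc n)\<close> to \<open>xb (Suc (Suc n))\<close> does not increase the
  divergence.\<close>

lemma carry_Suc_le: "carry (Suc n) \<le> slack n * D (xb (Suc n)) (xt (Suc n)) / 2"
proof -
  have s: "0 \<le> slack n" using eta_pos[of n] eta_pos[of "Suc n"] H_pos[of n] ga by (simp add: slack_def)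
  have nn: "0 \<le> D (xb (Suc n)) (xt (Suc n))" by (intro D_nonneg xb_in xt_in)
  have "D (xb (Suc (Suc n))) (xt (Suc n)) \<le> (1 - be (Suc n)) * D (xb (Suc n)) (xt (Suc n))"
    unfolding st_Suc(3)[of "Suc n"] using be_bounds[of n] xb_in xt_in
    by (intro bregman_convex_comb_le[OF cv]) auto
  also have "\<dots> \<le> 1 * D (xb (Suc n)) (xt (Suc n))"
    using be_bounds[of n] nn by (intro mult_right_mono) auto
  finally have "slack n * D (xb (Suc (Suc n))) (xt (Suc n)) \<le> slack n * D (xb (Suc n)) (xt (Suc n))"
    using s by (intro mult_left_mono) auto
  then show ?thesis unfolding carry_def st_Suc(6,8) slack_def[symmetric] by simp
qed

text \<open>Both estimates in \<open>lam n\<close> share the point \<open>xb (Suc n)\<close>, so the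
  gradient change is split there.\<close>

lemma gradient_change_le:
  "\<theta> / (2 * \<gamma>) * (eta (Suc n))\<^sup>2 * (norm (g (xt (Suc n)) - g (xt n)))\<^sup>2
    \<le> slack n * D (xb (Suc n)) (xt (Suc n)) / 2 + carry n"
proof -
  let ?b = "g (xb (Suc n))" and ?G = "g (xt n)" and ?G' = "g (xt (Suc n))"
  let ?c = "\<nu> * Hp n / etap n" and ?D = "D (xb (Suc n)) (xt n)" and ?D' = "D (xb (Suc n)) (xt (Suc n))"
  have nn: "0 \<le> ?D" "0 \<le> ?D'" by (intro D_nonneg xb_in xt_in)+
  note pos = eta_pos[of n] eta_pos[of "Suc n"] etap_pos[of n] Hp_pos[of n]
  have e: "eta (Suc n) \<le> (1 + \<gamma>) * eta n" using eta_le[of "Suc n"] by (simp add: st_Suc(6))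
  have "?G' - ?G = (?b - ?G) - (?b - ?G')" by simp
  then have "(norm (?G' - ?G))\<^sup>2 \<le> 2 * (norm (?b - ?G))\<^sup>2 + 2 * (norm (?b - ?G'))\<^sup>2"
    using sum_squares_bound[of "norm (?b - ?G)" "norm (?b - ?G')"]
      norm_triangle_ineq4[of "?b - ?G" "?b - ?G'"]
      power_mono[of "norm (?G' - ?G)" "norm (?b - ?G) + norm (?b - ?G')" 2]
    by (simp add: power2_sum)
  then have "eta (Suc n) * (norm (?G' - ?G))\<^sup>2 \<le> eta (Suc n) * (2 * (norm (?b - ?G))\<^sup>2 + 2 * (norm (?b - ?G'))\<^sup>2)"
    using pos by (intro mult_left_mono) auto
  also have "\<dots> = 2 * (eta (Suc n) * (norm (?b - ?G))\<^sup>2) + 2 * (eta (Suc n) * (norm (?b - ?G'))\<^sup>2)"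
    by (simp add: algebra_simps)
  also have "\<dots> \<le> 2 * (?c * (2 * ?D)) + 2 * (?c * (2 * ?D'))"
    by (intro add_mono mult_left_mono eta_curv) auto
  finally have "eta (Suc n) * (norm (?G' - ?G))\<^sup>2 \<le> 4 * ?c * (?D + ?D')"
    by (simp add: algebra_simps)
  then have "\<theta> / (2 * \<gamma>) * eta (Suc n) * (eta (Suc n) * (norm (?G' - ?G))\<^sup>2)
      \<le> \<theta> / (2 * \<gamma>) * eta (Suc n) * (4 * ?c * (?D + ?D'))"
    using th ga pos by (intro mult_left_mono) auto
  also have "\<dots> = (4 * \<nu> * \<theta> / \<gamma>) * (eta (Suc n) * Hp n / etap n) * (?D + ?D') / 2"
    by simp
  \<comment> \<open>The 4 in \<open>nu_eq\<close> is a 2 from splitting the square times a 2 from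
    the curvature bound.\<close>
  also have "4 * \<nu> * \<theta> / \<gamma> = 1 / (1 + \<gamma>)\<^sup>2"
    using nu_eq ga by (simp add: field_simps)
  finally have main: "\<theta> / (2 * \<gamma>) * (eta (Suc n))\<^sup>2 * (norm (?G' - ?G))\<^sup>2
      \<le> 1 / (1 + \<gamma>)\<^sup>2 * (eta (Suc n) * Hp n / etap n) * (?D + ?D') / 2"
    by (simp add: power2_eq_square mult_ac)
  \<comment> \<open>In each of the two bounds one factor \<open>1 + \<gamma>\<close> pays for
    stepsize growth: from \<open>eta n\<close> to \<open>eta (Suc n)\<close> here, from
    \<open>etap n\<close> to \<open>eta n\<close> in the next.\<close>
  have "1 / (1 + \<gamma>)\<^sup>2 * (eta (Suc n) * Hp n / etap n) = eta (Suc n) * Hp n / ((1 + \<gamma>)\<^sup>2 * etap n)"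
    by simp
  also have "\<dots> \<le> ((1 + \<gamma>) * eta n) * Hp n / ((1 + \<gamma>)\<^sup>2 * etap n)"
    using e pos ga by (intro divide_right_mono mult_right_mono) auto
  also have "\<dots> = eta n * Hp n / ((1 + \<gamma>) * etap n)"
    using ga pos by (simp add: power2_eq_square)
  finally have 1: "1 / (1 + \<gamma>)\<^sup>2 * (eta (Suc n) * Hp n / etap n) \<le> eta n * Hp n / ((1 + \<gamma>) * etap n)" .
  have "1 / (1 + \<gamma>)\<^sup>2 * (eta (Suc n) * Hp n / etap n) = eta (Suc n) * Hp n / ((1 + \<gamma>) * ((1 + \<gamma>) * etap n))"
    by (simp add: power2_eq_square)
  also have "\<dots> \<le> eta (Suc n) * H n / ((1 + \<gamma>) * eta n)"
    using eta_le[of n] Hp_le[of n] pos ga by (intro frac_le mult_left_mono mult_nonneg_nonneg mult_pos_pos) auto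
  finally have 2: "1 / (1 + \<gamma>)\<^sup>2 * (eta (Suc n) * Hp n / etap n) \<le> slack n" by (simp add: slack_def)
  have halves: "m \<le> v / 2 + u / 2" if "m \<le> (a + b) / 2" "a \<le> u" "b \<le> v" for m a b u v :: real
    using that by (simp add: add_divide_distrib)
  show ?thesis unfolding carry_def
    by (rule halves[OF main[unfolded distrib_left] mult_right_mono[OF 1 nn(1)] mult_right_mono[OF 2 nn(2)]])
qed

section \<open>Descent of the Lyapunov function\<close>

definition V :: "nat \<Rightarrow> real" where
  "V n = (norm (x (Suc n) - xs))\<^sup>2 / 2 + \<theta> * (norm (x (Suc n) - x n))\<^sup>2 / 2
     + H n * (f (xb (Suc n)) - f xs) + carry n"

text \<open>The quadratic form costs at most half of the divergence gained plus
  \<open>carry n\<close>; the other half covers \<open>carry (Suc n)\<close>.\<close>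

lemma V_Suc_le: "V (Suc n) \<le> V n"
proof -
  let ?d = "x (Suc n) - x n" and ?d' = "x (Suc (Suc n)) - x (Suc n)" and ?r = "eta (Suc n) / eta n"
  have r: "0 \<le> ?r" "?r \<le> 1 + \<gamma>"
    using eta_pos[of n] eta_pos[of "Suc n"] eta_le[of "Suc n"]
    by (auto simp: st_Suc(6) pos_divide_le_eq)
  have "?d' - ?r *\<^sub>R ?d = - eta (Suc n) *\<^sub>R (g (xt (Suc n)) - g (xt n))"
    unfolding st_Suc(2)[of "Suc n"] st_Suc(2)[of n] using eta_pos[of n] by (simp add: algebra_simps)
  then have "(norm (?d' - ?r *\<^sub>R ?d))\<^sup>2 = (eta (Suc n))\<^sup>2 * (norm (g (xt (Suc n)) - g (xt n)))\<^sup>2"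
    by (simp add: power_mult_distrib)
  then have "(1 + \<theta>) * (norm ?d')\<^sup>2 - 2 * \<theta> * inner ?d' ?d - \<theta> * (norm ?d)\<^sup>2
      \<le> 2 * (slack n * D (xb (Suc n)) (xt (Suc n)) / 2 + carry n)"
    using increment_quadratic_form[OF th ga r par, of ?d' ?d] gradient_change_le[of n] by simp
  then show ?thesis
    unfolding V_def using distance_identity[of n] linearization_ge[of n] carry_Suc_le[of n]
    by (simp add: algebra_simps)
qed

lemma V_0_le: "V 0 \<le> (1 + \<theta> / 2) * (norm (x0 - xs))\<^sup>2"
proof -
  let ?p = "x0 - xs"
  have x1: "x (Suc 0) = x0 - eta0 *\<^sub>R g x0" "x 0 = x0" "xb (Suc 0) = x0" "xt 0 = x0"
    "H 0 = eta0"
    unfolding st_Suc(2,3) by (simp_all add: st_0 graal_init_def)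
  \<comment> \<open>Since \<open>be 0 = 1\<close>, the point \<open>xb (Suc 0)\<close> equals
    \<open>xt 0\<close> and the divergence in \<open>carry 0\<close> is 0.\<close>
  have carry0: "carry 0 = 0" by (simp add: carry_def x1 bregman_def)
  have "g xs = 0" by (rule gradient_at_minimum[OF S gr L lip xs min])
  then have "norm (g x0) \<le> L * norm ?p" using lip[OF x0 xs] by simp
  then have "eta0 * norm (g x0) \<le> eta0 * (L * norm ?p)" using eta0 by (intro mult_left_mono) auto
  also have "\<dots> \<le> 1 * norm ?p" unfolding mult.assoc[symmetric] using eta0 by (intro mult_right_mono) auto
  finally have "(eta0 * norm (g x0))\<^sup>2 \<le> (norm ?p)\<^sup>2" using eta0 by (intro power_mono) auto
  then have d: "(norm (x (Suc 0) - x 0))\<^sup>2 \<le> (norm ?p)\<^sup>2"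
    using eta0 by (simp add: x1 power_mult_distrib)
  \<comment> \<open>Convexity bounds the initial gap by the very inner product that the expansion of
    the first step subtracts.\<close>
  have "0 \<le> D xs x0" by (rule D_nonneg[OF xs x0])
  then have "f x0 - f xs \<le> inner (g x0) ?p" by (simp add: bregman_def inner_diff_right)
  then have F: "eta0 * (f x0 - f xs) \<le> eta0 * inner (g x0) ?p"
    using eta0 by (intro mult_left_mono) auto
  have "x (Suc 0) - xs = ?p - eta0 *\<^sub>R g x0" by (simp add: x1)
  then have "(norm (x (Suc 0) - xs))\<^sup>2 = (norm ?p)\<^sup>2 - 2 * (eta0 * inner (g x0) ?p) + (norm (x (Suc 0) - x 0))\<^sup>2"
    by (simp only: x1 power2_norm_eq_inner)
      (simp add: inner_diff_left inner_diff_right inner_commute algebra_simps)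
  then have "V 0 \<le> (norm ?p)\<^sup>2 / 2 + (1 + \<theta>) * (norm (x (Suc 0) - x 0))\<^sup>2 / 2"
    unfolding V_def carry0 x1(3,5) using F by (simp add: distrib_right add_divide_distrib diff_divide_distrib)
  also have "\<dots> \<le> (norm ?p)\<^sup>2 / 2 + (1 + \<theta>) * (norm ?p)\<^sup>2 / 2"
    using d th by (intro add_left_mono divide_right_mono mult_left_mono) auto
  finally show ?thesis by (simp add: algebra_simps add_divide_distrib)
qed

lemma function_value_bound: "H n * (f (xb (Suc n)) - f xs) \<le> (1 + \<theta> / 2) * (norm (x0 - xs))\<^sup>2"
proof -
  have "V n \<le> V 0"
    by (induction n) (use V_Suc_le order_trans in \<open>blast+\<close>)
  moreover have "0 \<le> carry n"
    using eta_pos[of n] etap_pos[of n] Hp_pos[of n] ga D_nonneg[OF xb_in xt_in]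
    by (simp add: carry_def)
  ultimately show ?thesis using V_0_le th unfolding V_def
    by (smt (verit) zero_le_power2 divide_nonneg_nonneg mult_nonneg_nonneg)
qed

section \<open>Growth of \<open>H\<close> and the iteration count\<close>

lemma H_growth:
  "real n * ln (1 + \<gamma>) + ln \<nu> + ln (eta0 * L)
    \<le> (2 + 2 * (4 + \<bar>2 * ln (1 + \<gamma>) - ln \<nu>\<bar> / sqrt (\<nu> / (1 + (1 + \<gamma>))))) * sqrt (H (n + 2) * L)"
proof -
  \<comment> \<open>\<open>par(2)\<close> and \<open>nu_eq\<close> give
    \<open>\<nu> \<le> \<gamma>\<close>, and \<open>par(1)\<close> gives
    \<open>\<gamma> \<le> 1\<close>.\<close>
  have "\<nu> \<le> 1"
  proof -
    have "(1 + \<theta>) * 1 \<le> (1 + \<theta>) * (1 + \<gamma>)" using th ga by (intro mult_left_mono) auto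
    then have "1 \<le> 4 * \<theta>" using par(2) by simp
    moreover have "1 \<le> (1 + \<gamma>)\<^sup>2" using ga by simp
    ultimately have "1 * 1 \<le> 4 * \<theta> * (1 + \<gamma>)\<^sup>2" by (intro mult_mono) auto
    then have "\<nu> * 1 \<le> \<nu> * (4 * \<theta> * (1 + \<gamma>)\<^sup>2)" using nu by (intro mult_left_mono) auto
    also have "\<dots> = \<gamma>" using nu_eq by (simp add: mult_ac)
    finally have "\<nu> \<le> \<gamma>" by simp
    have "\<gamma> * \<theta> \<le> \<gamma> * (2 * \<theta> + 1)" using th ga by (intro mult_left_mono) auto
    also have "\<dots> \<le> 1 * \<theta>" using par(1) by simp
    finally have "\<gamma> \<le> 1" using th by simp
    with \<open>\<nu> \<le> \<gamma>\<close> show ?thesis by simp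
  qed
  \<comment> \<open>As \<open>Hp 0 = etap 0\<close>, the second candidate in \<open>eta_ge\<close>
    is \<open>\<nu> / L\<close> at the first step.\<close>
  moreover have "min ((1 + \<gamma>) * (eta 0 * L)) \<nu> \<le> eta 1 * L"
  proof -
    have e: "min ((1 + \<gamma>) * eta0) (\<nu> / L) \<le> eta 1"
      using eta_ge[of 0] eta0 L by (simp add: st_0 graal_init_def)
    show ?thesis
      using mult_right_mono[OF e, of L] L by (simp add: st_0 graal_init_def min_mult_distrib_right)
  qed
  moreover have "min ((1 + \<gamma>) * (eta (Suc k) * L)) (\<nu> * (H k * L) / (eta k * L)) \<le> eta (Suc (Suc k)) * L" for k
    using mult_right_mono[OF eta_ge[of "Suc k"], of L] L
    by (simp add: st_Suc(6,8) min_mult_distrib_right)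
  moreover have "eta (Suc k) * L \<le> (1 + \<gamma>) * (eta k * L)" for k
    using mult_right_mono[OF eta_le[of "Suc k"], of L] L by (simp add: st_Suc(6))
  ultimately have "real n * ln (1 + \<gamma>) + ln \<nu> + ln (eta 0 * L)
    \<le> (2 + 2 * (4 + \<bar>2 * ln (1 + \<gamma>) - ln \<nu>\<bar> / sqrt (\<nu> / (1 + (1 + \<gamma>))))) * sqrt (H (n + 2) * L)"
    using ga nu L eta_pos eta_le_H eta0
    by (intro sqrt_growth[where u = "\<lambda>k. eta k * L" and G = "\<lambda>k. H k * L"])
      (auto simp: st_Suc(7) distrib_right st_0 graal_init_def)
  then show ?thesis by (simp add: st_0 graal_init_def)
qed

lemma graal_output_eq: "graal_output \<theta> \<gamma> \<nu> f g x0 eta0 K = xb K"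
  by (simp add: graal_output_def st_def)

lemma output_accuracy:
  assumes e: "\<epsilon> > 0"
  defines "M \<equiv> 2 + 2 * (4 + \<bar>2 * ln (1 + \<gamma>) - ln \<nu>\<bar> / sqrt (\<nu> / (1 + (1 + \<gamma>))))"
  assumes K: "real K \<ge> 3" "real K * ln (1 + \<gamma>)
    \<ge> 3 * ln (1 + \<gamma>) - ln \<nu> + ln (1 / (eta0 * L)) + M * sqrt (1 + \<theta> / 2) * sqrt (L * (norm (x0 - xs))\<^sup>2 / \<epsilon>)"
  shows "f (xb K) - f xs \<le> \<epsilon>"
proof -
  \<comment> \<open>The offset is 3 because \<open>H_growth\<close> reaches
    \<open>H (n + 2)\<close>, which \<open>function_value_bound\<close> pairs with
    \<open>xb (n + 3)\<close>.\<close>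
  obtain n where n: "K = n + 3" using K(1) by (metis add.commute le_Suc_ex of_nat_le_iff of_nat_numeral)
  have "sqrt (\<nu> / (1 + (1 + \<gamma>))) \<ge> 0" using nu ga by simp
  then have M: "M > 0" by (simp add: M_def add_pos_nonneg)
  have "ln (1 / (eta0 * L)) = - ln (eta0 * L)" using eta0 L by (simp add: ln_div)
  then have "M * (sqrt (1 + \<theta> / 2) * sqrt (L * (norm (x0 - xs))\<^sup>2 / \<epsilon>))
      \<le> real n * ln (1 + \<gamma>) + ln \<nu> + ln (eta0 * L)"
    using K(2) by (simp add: n algebra_simps)
  also have "\<dots> \<le> M * sqrt (H (n + 2) * L)" unfolding M_def by (rule H_growth)
  finally have "sqrt (1 + \<theta> / 2) * sqrt (L * (norm (x0 - xs))\<^sup>2 / \<epsilon>) \<le> sqrt (H (n + 2) * L)"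
    using M by simp
  then have "(1 + \<theta> / 2) * (L * (norm (x0 - xs))\<^sup>2 / \<epsilon>) \<le> H (n + 2) * L"
    by (simp add: real_sqrt_mult[symmetric])
  then have "L * ((1 + \<theta> / 2) * (norm (x0 - xs))\<^sup>2) \<le> L * (H (n + 2) * \<epsilon>)"
    using e by (simp add: field_simps)
  then have "(1 + \<theta> / 2) * (norm (x0 - xs))\<^sup>2 \<le> H (n + 2) * \<epsilon>"
    using L by simp
  with function_value_bound[of "n + 2"] have "H (n + 2) * (f (xb K) - f xs) \<le> H (n + 2) * \<epsilon>"
    by (simp add: n numeral_3_eq_3)
  then show ?thesis using H_pos[of "n + 2"] by simp
qed

end

section \<open>Choice of the constant\<close>

theorem corollary2:
  fixes \<theta> \<gamma> \<nu> :: real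
  assumes "\<theta> > 0" and "\<gamma> > 0" and "\<nu> > 0"
    and "4 * \<nu> * \<theta> * (1 + \<gamma>)\<^sup>2 = \<gamma>"
    and "1 + 2 * \<gamma> + 2 * \<gamma> * \<theta>\<^sup>2 / (1 + \<theta>)\<^sup>2 \<le> \<theta> / (1 + \<theta>) + \<theta>\<^sup>2 / (1 + \<theta>)\<^sup>2"
  shows "\<exists>C::real. C > 0 \<and>
    (\<forall>(d::nat) (f :: fseq \<Rightarrow> real) (g :: fseq \<Rightarrow> fseq) (L::real)
      (xs::fseq) (x0::fseq) (\<epsilon>::real) (eta0::real).
        convex_on (eucl d) f \<longrightarrow>
        is_gradient_on (eucl d) f g \<longrightarrow>
        continuous_on (eucl d) g \<longrightarrow>
        L > 0 \<longrightarrow>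
        (\<forall>x\<in>eucl d. \<forall>z\<in>eucl d. norm (g x - g z) \<le> L * norm (x - z)) \<longrightarrow>
        xs \<in> eucl d \<longrightarrow>
        (\<forall>x\<in>eucl d. f xs \<le> f x) \<longrightarrow>
        x0 \<in> eucl d \<longrightarrow>
        \<epsilon> > 0 \<longrightarrow>
        eta0 > 0 \<longrightarrow>
        eta0 * L \<le> 1 \<longrightarrow>
        (\<forall>K::nat. K \<ge> 1 \<longrightarrow>
          real K \<ge> C * (1 + sqrt (L * (norm (x0 - xs))\<^sup>2 / \<epsilon>) + ln (1 / (eta0 * L))) \<longrightarrow>
          f (graal_output \<theta> \<gamma> \<nu> f g x0 eta0 K) - f xs \<le> \<epsilon>))"
proof -
  define q where "q = ln (1 + \<gamma>)"
  define M where "M = (2 + 2 * (4 + \<bar>2 * ln (1 + \<gamma>) - ln \<nu>\<bar> / sqrt (\<nu> / (1 + (1 + \<gamma>)))))"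
  define a where "a = M * sqrt (1 + \<theta> / 2)"
  \<comment> \<open>\<open>C * q\<close> has to dominate the three coefficients in
    \<open>output_accuracy\<close>: \<open>3 * q - ln \<nu>\<close> of the constant,
    \<open>a\<close> of the square root and 1 of the logarithm. The summand 3 also ensures
    \<open>K \<ge> 3\<close>.\<close>
  define C where "C = 3 + \<bar>ln \<nu>\<bar> / q + a / q + 1 / q"
  have q: "q > 0" using assms(2) by (simp add: q_def)
  have "M > 0" using assms(2,3) by (auto simp: M_def intro!: add_pos_nonneg)
  then have a: "a \<ge> 0" using assms(1) by (simp add: a_def)
  have C3: "C \<ge> 3" using q a by (simp add: C_def)
  have Cq: "C * q = 3 * q + \<bar>ln \<nu>\<bar> + a + 1" using q by (simp add: C_def distrib_right)
  have par: "\<gamma> * (2 * \<theta> + 1) \<le> \<theta>" "(1 + \<theta>) * (1 + \<gamma>) \<le> 2 * \<theta>"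
    using parameter_bounds assms by blast+
  have "f (graal_output \<theta> \<gamma> \<nu> f g x0 eta0 K) - f xs \<le> \<epsilon>"
    if h: "convex_on (eucl d) f" "is_gradient_on (eucl d) f g" "L > 0"
      "\<forall>x\<in>eucl d. \<forall>z\<in>eucl d. norm (g x - g z) \<le> L * norm (x - z)"
      "xs \<in> eucl d" "\<forall>x\<in>eucl d. f xs \<le> f x" "x0 \<in> eucl d" "\<epsilon> > 0" "eta0 > 0" "eta0 * L \<le> 1"
      "real K \<ge> C * (1 + sqrt (L * (norm (x0 - xs))\<^sup>2 / \<epsilon>) + ln (1 / (eta0 * L)))"
    for d f g L xs x0 \<epsilon> eta0 and K :: nat
  proof -
    interpret graal "eucl d" f g L \<theta> \<gamma> \<nu> eta0 xs x0
      by unfold_locales (use h assms par subspace_eucl in auto)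
    define s where "s = sqrt (L * (norm (x0 - xs))\<^sup>2 / \<epsilon>)"
    define l where "l = ln (1 / (eta0 * L))"
    have s: "s \<ge> 0" using h(3,8) by (simp add: s_def)
    have l: "l \<ge> 0" using h(3,9,10) by (simp add: l_def)
    have "C * 1 \<le> C * (1 + s + l)" using C3 s l by (intro mult_left_mono) auto
    then have K3: "real K \<ge> 3" using h(11) C3 unfolding s_def l_def by linarith
    have "3 * q - ln \<nu> + l + a * s \<le> C * q * (1 + s + l)"
    proof -
      have "3 * q + \<bar>ln \<nu>\<bar> \<le> C * q" "a \<le> C * q" "1 \<le> C * q"
        using Cq a q by simp_all
      moreover from this have "a * s \<le> C * q * s" "1 * l \<le> C * q * l"
        using s l by (simp_all only: mult_right_mono)
      ultimately show ?thesis by (simp add: distrib_left)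
    qed
    also have "\<dots> = C * (1 + s + l) * q" by simp
    also have "\<dots> \<le> real K * q" using h(11) q by (intro mult_right_mono) (auto simp: s_def l_def)
    finally show ?thesis unfolding graal_output_eq
      using K3 h(8) by (intro output_accuracy) (auto simp: s_def l_def q_def a_def M_def)
  qed
  moreover have "C > 0" using C3 by simp
  ultimately show ?thesis by (intro exI[of _ C]) blast
qed

end
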